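(* Let $\mathcal{T}$ be the rooted tree whose vertices are all semi-Baxter permutations of size $\geq 1$, whose root is the permutation $1$ of size $1$, and in which the children of a semi-Baxter permutation $\pi$ of size $n$ are exactly the permutations $\pi\cdot a$, $a\in\{1,\dots,n+1\}$, that are semi-Baxter. Then $\mathcal{T}$ is a generating tree for semi-Baxter permutations (every semi-Baxter permutation of size $n$ appears exactly once, at level $n$), and $\mathcal{T}$ is isomorphic (as a rooted tree) to the tree generated by the succession rule $$\Omega_{semi}=\left\{\begin{array}{l}(1,1)\\ (h,k)\rightsquigarrow (1,k+1),\dots,(h,k+1),\\ \phantom{(h,k)\rightsquigarrow{}}(h+k,1),(h+k-1,2),\dots,(h+1,k).\end{array}\right.$$
   Context: A permutation $\pi=\pi_1\cdots\pi_n$ of $\{1,\dots,n\}$ is semi-Baxter if there are no indices $i<j$ and $k>j+1$ with $\pi_{j+1}<\pi_i<\pi_k<\pi_j$ (that is, $\pi$ avoids the vincular pattern $2413$ in which the entries $4$ and $1$ must be adjacent). For a permutation $\pi$ of size $n$ and $a\in\{1,\dots,n+1\}$, $\pi\cdot a$ (insertion of $a$ on the right) is the permutation $\pi'$ of size $n+1$ with $\pi'_{n+1}=a$ and, for $i\leq n$, $\pi'_i=\pi_i$ if $\pi_i<a$ and $\pi'_i=\pi_i+1$ if $\pi_i\geq a$. A generating tree for a class of objects is an infinite rooted tree whose vertices are the objects, each appearing exactly once, objects of size $n$ being at level $n$ (the root is at level $1$). A succession rule consists of a root label and productions $\ell\rightsquigarrow \ell_1,\dots,\ell_m$; the tree it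 generates is the rooted tree with labelled nodes in which the root has the root label and every node labelled $\ell$ has $m$ children labelled $\ell_1,\dots,\ell_m$. In $\Omega_{semi}$, a node labelled $(h,k)$ has the $h$ children $(i,k+1)$, $1\leq i\leq h$, and the $k$ children $(h+k+1-i,i)$, $1\leq i\leq k$. *)

theory Defs
  imports
    "Graph_Theory.Pair_Digraph"
    "Graph_Theory.Digraph_Isomorphism"
    "HOL-Combinatorics.Multiset_Permutations"
begin

text \<open>
  Arcs are directed from parent to child. The library's \<open>tree\<close> is unsuitable here: it excludes
  only directed cycles, so a vertex could have several parents.
\<close>

definition rooted_tree :: "'a pair_pre_digraph \<Rightarrow> 'a \<Rightarrow> bool" where
  "rooted_tree T r \<longleftrightarrow>
     pair_wf_digraph T \<and> r \<in> pverts T \<and>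
     (\<forall>v \<in> pverts T. \<exists>!p. pre_digraph.awalk (with_proj T) r p v)"

text \<open>Levels are counted from 1: the root is at level 1.\<close>

definition level :: "'a pair_pre_digraph \<Rightarrow> 'a \<Rightarrow> 'a \<Rightarrow> nat" where
  "level T r v = length (THE p. pre_digraph.awalk (with_proj T) r p v) + 1"

definition rooted_tree_iso ::
  "'a pair_pre_digraph \<Rightarrow> 'a \<Rightarrow> 'b pair_pre_digraph \<Rightarrow> 'b \<Rightarrow> bool" where
  "rooted_tree_iso S r T s \<longleftrightarrow>
     (\<exists>f. pre_digraph.digraph_isomorphism (with_proj S) f \<and>
          with_proj T = app_iso f (with_proj S) \<and> iso_verts f r = s)"

text \<open>
  The vertices are the objects of the class \<open>C\<close> themselves, so that
  \<open>pverts T = C\<close> says that each object appears exactly once.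
\<close>

definition generating_tree ::
  "'a pair_pre_digraph \<Rightarrow> 'a \<Rightarrow> 'a set \<Rightarrow> ('a \<Rightarrow> nat) \<Rightarrow> bool" where
  "generating_tree T r C size_of \<longleftrightarrow>
     rooted_tree T r \<and> infinite (pverts T) \<and> pverts T = C \<and>
     (\<forall>x \<in> C. level T r x = size_of x)"

record 'l succession_rule =
  root_label :: 'l
  productions :: "'l \<Rightarrow> 'l list"

text \<open>
  A node of the tree generated by a rule is a pair \<open>(w, l)\<close>, where \<open>l\<close> is its label and the
  address \<open>w\<close> is the sequence of (0-based) child indices leading to it from the root. The
  address keeps apart different nodes that carry the same label.
\<close>

inductive_set rule_nodes :: "'l succession_rule \<Rightarrow> (nat list \<times> 'l) set"
  for R :: "'l succession_rule" where
  root_node: "([], root_label R) \<in> rule_nodes R"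
| child_node: "(w, l) \<in> rule_nodes R \<Longrightarrow> i < length (productions R l) \<Longrightarrow>
    (w @ [i], productions R l ! i) \<in> rule_nodes R"

definition rule_tree :: "'l succession_rule \<Rightarrow> (nat list \<times> 'l) pair_pre_digraph" where
  "rule_tree R =
     \<lparr> pverts = rule_nodes R,
       parcs = {((w, l), (w @ [i], productions R l ! i)) | w l i.
                  (w, l) \<in> rule_nodes R \<and> i < length (productions R l)} \<rparr>"

definition rule_root :: "'l succession_rule \<Rightarrow> nat list \<times> 'l" where
  "rule_root R = ([], root_label R)"

definition Omega_semi :: "(nat \<times> nat) succession_rule" where
  "Omega_semi =
     \<lparr> root_label = (1, 1),
       productions = (\<lambda>(h, k). map (\<lambda>i. (i, k + 1)) [1..<h + 1] @
                               map (\<lambda>i. (h + k + 1 - i, i)) [1..<k + 1]) \<rparr>"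

text \<open>
  A permutation of \<open>{1..n}\<close> is the list of its values in one-line notation. List positions
  are 0-based, values are 1-based.
\<close>

definition is_perm :: "nat list \<Rightarrow> bool" where
  "is_perm p \<longleftrightarrow> p \<in> permutations_of_set {1..length p}"

definition semi_baxter :: "nat list \<Rightarrow> bool" where
  "semi_baxter p \<longleftrightarrow> is_perm p \<and>
     \<not> (\<exists>i j k. i < j \<and> j + 1 < k \<and> k < length p \<and>
          p ! (j + 1) < p ! i \<and> p ! i < p ! k \<and> p ! k < p ! j)"

definition insert_right :: "nat list \<Rightarrow> nat \<Rightarrow> nat list" where
  "insert_right p a = map (\<lambda>x. if x < a then x else x + 1) p @ [a]"

definition semi_baxter_perms :: "nat list set" where
  "semi_baxter_perms = {p. semi_baxter p \<and> length p \<ge> 1}"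

definition semi_baxter_tree :: "nat list pair_pre_digraph" where
  "semi_baxter_tree =
     \<lparr> pverts = semi_baxter_perms,
       parcs = {(p, insert_right p a) | p a.
                  p \<in> semi_baxter_perms \<and> a \<in> {1..length p + 1} \<and>
                  semi_baxter (insert_right p a)} \<rparr>"

end

theory Submission
  imports Defs
begin

text \<open>
  Call a value \<open>a\<close> an active site of a semi-Baxter permutation \<open>\<pi>\<close> if \<open>\<pi> \<cdot> a\<close> is again semi-Baxter.
  The site \<open>a\<close> fails to be active exactly when some descent of \<open>\<pi>\<close> straddles it, with an earlier
  entry lying strictly between the bottom of the descent and \<open>a\<close>: such a triple together with
  the new last entry \<open>a\<close> is a forbidden 2413. Label \<open>\<pi>\<close> by \<open>(h, k)\<close>, the numbers of active sites
  at most, respectively greater than, its last entry.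

  Appending \<open>a\<close> splits the site \<open>a\<close> into \<open>a\<close> and \<open>a + 1\<close> and shifts the higher sites up by one
  without changing which of them are blocked by old descents. If \<open>a\<close> lies above the last entry
  \<open>\<ell>\<close>, no descent is created and only the position of the last entry among the sites changes, so
  that \<open>h + k\<close> grows by one; as \<open>a\<close> decreases from the highest site, the labels are
  \<open>(h + k, 1), \<dots>, (h + 1, k)\<close>. If \<open>a \<le> \<ell>\<close>, the new last descent has the entry \<open>a + 1\<close> to its left
  (when \<open>a < \<ell>\<close>), so it blocks all sites from \<open>a + 2\<close> to the top \<open>\<ell> + 1\<close> of that descent and no
  others. What survives is the sites up to \<open>a\<close>, the site \<open>a + 1\<close> and the \<open>k\<close> sites above \<open>\<ell>\<close>, and
  as \<open>a\<close> increases the labels are \<open>(1, k + 1), \<dots>, (h, k + 1)\<close>. This computation is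
  \<open>active_insert_right\<close>, and \<open>site_labels_of_children\<close> draws the conclusion that the labels of the
  children of \<open>\<pi>\<close>, listed in a suitable order, are the productions of \<open>(h, k)\<close>.

  The rest is independent of permutations. Deleting the last entry makes the parent of a
  permutation unique and its size one smaller, and a family in which every object but one has a
  unique parent of smaller size forms a rooted tree (\<open>graded_family\<close>). If in addition
  the children are ordered and labelled as a succession rule demands, then following child
  indices from the root sends each node of the tree generated by the rule to an object, and this
  is an isomorphism (\<open>labelled_family\<close>).
\<close>

section \<open>Rooted trees given by unique parents\<close>

text \<open>
  Parents one step closer to the root replace any acyclicity or connectedness condition: climbing
  to the parent terminates, and it can only terminate at the root.
\<close>

locale graded_family =
  fixes T :: "'a pair_pre_digraph" and r :: 'a and depth :: "'a \<Rightarrow> nat"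
  assumes wf: "pair_wf_digraph T"
    and root_vertex: "r \<in> pverts T"
    and depth_root: "depth r = 1"
    and depth_pos: "x \<in> pverts T \<Longrightarrow> 1 \<le> depth x"
    and depth_arc: "(x, y) \<in> parcs T \<Longrightarrow> depth y = depth x + 1"
    and ex_parent: "y \<in> pverts T \<Longrightarrow> y \<noteq> r \<Longrightarrow> \<exists>x. (x, y) \<in> parcs T"
    and parent_unique: "(x, y) \<in> parcs T \<Longrightarrow> (x', y) \<in> parcs T \<Longrightarrow> x = x'"
begin

sublocale pair_wf_digraph T
  by (rule wf)

lemma no_arc_to_root: "(x, r) \<notin> parcs T"
  using depth_arc[of x r] depth_root depth_pos[of x] in_arcsD1[of x r] by fastforce

lemma awalk_snoc_iff:
  "awalk u (p @ [e]) v \<longleftrightarrow> e \<in> parcs T \<and> snd e = v \<and> awalk u p (fst e)"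
  by (induction p arbitrary: u)
     (auto simp: awalk_Cons_iff awalk_Nil_iff arc_fst_in_verts arc_snd_in_verts)

text \<open>
  Since every arc raises the depth by one, all walks from the root to a vertex have the same
  length. This settles the level and makes the induction for uniqueness possible.
\<close>

lemma length_awalk: "awalk r p v \<Longrightarrow> length p + 1 = depth v"
proof (induction p arbitrary: v rule: rev_induct)
  case Nil
  then show ?case using depth_root by (auto simp: awalk_Nil_iff)
next
  case (snoc e p)
  then show ?case
    using depth_arc[of "fst e" "snd e"] by (force simp: awalk_snoc_iff)
qed

lemma awalk_unique: "awalk r p v \<Longrightarrow> awalk r q v \<Longrightarrow> p = q"
proof (induction p arbitrary: q v rule: rev_induct)
  case Nil
  then show ?case
    using length_awalk[OF Nil.prems(1)] length_awalk[OF Nil.prems(2)] by simp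
next
  case (snoc e p)
  have "length q = length (p @ [e])"
    using length_awalk[OF snoc.prems(1)] length_awalk[OF snoc.prems(2)] by simp
  then obtain q' e' where q: "q = q' @ [e']"
    by (cases q rule: rev_cases) auto
  have e: "e \<in> parcs T" "snd e = v" "awalk r p (fst e)"
    and e': "e' \<in> parcs T" "snd e' = v" "awalk r q' (fst e')"
    using snoc.prems by (auto simp: q awalk_snoc_iff)
  have "fst e = fst e'"
    using parent_unique[of "fst e" v "fst e'"] e e' by (metis prod.collapse)
  then show ?case
    using snoc.IH[of "fst e" q'] e e' by (simp add: q prod_eq_iff)
qed

lemma ex_awalk: "v \<in> pverts T \<Longrightarrow> \<exists>p. awalk r p v"
proof (induction "depth v" arbitrary: v rule: less_induct)
  case less
  show ?case
  proof (cases "v = r")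
    case True
    then have "awalk r [] v" using root_vertex by (simp add: awalk_Nil_iff)
    then show ?thesis by blast
  next
    case False
    then obtain u where u: "(u, v) \<in> parcs T"
      using ex_parent less.prems by blast
    then obtain p where "awalk r p u"
      using less.hyps[of u] depth_arc[OF u] in_arcsD1[OF u] by auto
    then have "awalk r (p @ [(u, v)]) v"
      using u by (simp only: awalk_snoc_iff fst_conv snd_conv)
    then show ?thesis by blast
  qed
qed

lemma rooted_tree: "rooted_tree T r"
  unfolding rooted_tree_def
  using wf root_vertex ex_awalk awalk_unique by blast

lemma level_eq_depth:
  assumes "v \<in> pverts T"
  shows "level T r v = depth v"
proof -
  obtain p where p: "awalk r p v" using ex_awalk[OF assms] by blast
  then have "(THE p. awalk r p v) = p" using awalk_unique by blast
  then show ?thesis using length_awalk[OF p] by (simp add: level_def)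
qed

end

section \<open>Labelled families and succession rules\<close>

text \<open>
  The bijection is given from \<open>T\<close> to \<open>S\<close>, against the direction of the isomorphism, because the
  natural map goes from addresses to objects. A digraph isomorphism must also specify the new head
  and tail functions; between pair digraphs these are the projections.
\<close>

lemma rooted_tree_isoI:
  fixes S :: "'a pair_pre_digraph" and T :: "'b pair_pre_digraph"
  assumes wf: "pair_wf_digraph T"
    and bij: "bij_betw g (pverts T) (pverts S)"
    and arcs: "parcs S = map_prod g g ` parcs T"
    and s: "s \<in> pverts T"
  shows "rooted_tree_iso S (g s) T s"
proof -
  define f where "f = the_inv_into (pverts T) g"
  have fg: "f (g x) = x" if "x \<in> pverts T" for x
    using bij that by (simp add: f_def bij_betw_def the_inv_into_f_f)
  have ends: "fst e \<in> pverts T" "snd e \<in> pverts T" if "e \<in> parcs T" for e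
    using wf that unfolding pair_wf_digraph_def by blast+
  have fg_arc: "map_prod f f (map_prod g g e) = e" if "e \<in> parcs T" for e
    using ends[OF that] by (simp add: fg prod_eq_iff)
  have verts: "pverts S = g ` pverts T"
    using bij by (simp add: bij_betw_def)
  define h where "h = \<lparr>iso_verts = f, iso_arcs = map_prod f f, iso_head = snd, iso_tail = fst\<rparr>"
  have "pair_wf_digraph S"
    using ends by (auto simp: pair_wf_digraph_def verts arcs)
  moreover have "inj_on f (pverts S)"
    by (rule inj_on_inverseI[of _ g]) (auto simp: verts fg)
  moreover have "inj_on (map_prod f f) (parcs S)"
  proof (rule inj_on_inverseI)
    fix e assume "e \<in> parcs S"
    then show "map_prod g g (map_prod f f e) = e"
      unfolding arcs using fg_arc by (metis imageE)
  qed
  ultimately have "pre_digraph.digraph_isomorphism (with_proj S) h"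
    by (simp add: pre_digraph.digraph_isomorphism_def wf_digraph_wp_iff h_def)
  moreover have "f ` pverts S = pverts T"
    by (force simp: verts image_image fg)
  moreover have "map_prod f f ` parcs S = parcs T"
    using fg_arc by (force simp: arcs image_image)
  ultimately show ?thesis
    unfolding rooted_tree_iso_def
    by (intro exI[of _ h]) (simp add: h_def app_iso_def with_proj_def fg s)
qed

text \<open>
  The parent of a node is found by dropping the last letter of its address.
\<close>

lemma rule_node_snocD:
  assumes "(w @ [i], l) \<in> rule_nodes R"
  shows "\<exists>m. (w, m) \<in> rule_nodes R \<and> i < length (productions R m) \<and> l = productions R m ! i"
  using assms by (cases rule: rule_nodes.cases) auto

text \<open>
  The children carry an order so that the \<open>i\<close>-th child of an object can be matched with the \<open>i\<close>-th
  production of its label; only the labels have to follow the rule.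
\<close>

locale labelled_family = graded_family T r depth
  for T :: "'a pair_pre_digraph" and r depth +
  fixes children :: "'a \<Rightarrow> 'a list" and label :: "'a \<Rightarrow> 'l" and R :: "'l succession_rule"
  assumes arcs_children: "parcs T = {(x, y). x \<in> pverts T \<and> y \<in> set (children x)}"
    and distinct_children: "x \<in> pverts T \<Longrightarrow> distinct (children x)"
    and label_root: "label r = root_label R"
    and label_children: "x \<in> pverts T \<Longrightarrow> map label (children x) = productions R (label x)"
begin

definition descend :: "nat list \<Rightarrow> 'a" where
  "descend w = foldl (\<lambda>x i. children x ! i) r w"

lemma descend_Nil [simp]: "descend [] = r"
  and descend_snoc [simp]: "descend (w @ [i]) = children (descend w) ! i"
  by (simp_all add: descend_def)

lemma length_children: "x \<in> pverts T \<Longrightarrow> length (children x) = length (productions R (label x))"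
  using label_children by (metis length_map)

lemma descend_rule_node:
  "(w, l) \<in> rule_nodes R \<Longrightarrow> descend w \<in> pverts T \<and> label (descend w) = l"
proof (induction w l rule: rule_nodes.induct)
  case root_node
  then show ?case by (simp add: root_vertex label_root)
next
  case (child_node w l i)
  then have i: "i < length (children (descend w))"
    by (simp add: length_children)
  then have "(descend w, children (descend w) ! i) \<in> parcs T"
    using child_node by (simp add: arcs_children)
  moreover have "label (children (descend w) ! i) = productions R l ! i"
    using child_node i label_children[of "descend w"] by (metis nth_map)
  ultimately show ?case by (auto dest: in_arcsD2)
qed

lemma descend_arc:
  assumes "(w, l) \<in> rule_nodes R" and "i < length (productions R l)"
  shows "(descend w, descend (w @ [i])) \<in> parcs T"
  using descend_rule_node[OF assms(1)] assms(2) by (simp add: arcs_children length_children)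

text \<open>
  Two addresses of the same object end in the same step, because the object has only one parent
  and occurs only once among the children of that parent; so the addresses can be compared letter by
  letter from the right.
\<close>

lemma descend_inj:
  "(w, l) \<in> rule_nodes R \<Longrightarrow> (w', l') \<in> rule_nodes R \<Longrightarrow> descend w = descend w' \<Longrightarrow> w = w'"
proof (induction w arbitrary: l w' l' rule: rev_induct)
  case Nil
  show ?case
  proof (cases w' rule: rev_cases)
    case (snoc u j)
    have "(u @ [j], l') \<in> rule_nodes R" using Nil.prems(2) snoc by simp
    then obtain m where "(u, m) \<in> rule_nodes R" "j < length (productions R m)"
      by (blast dest: rule_node_snocD)
    then have "(descend u, descend w') \<in> parcs T"
      unfolding snoc by (rule descend_arc)
    then show ?thesis using Nil.prems(3) no_arc_to_root by simp
  qed simp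
next
  case (snoc i w)
  obtain m where m: "(w, m) \<in> rule_nodes R" "i < length (productions R m)"
    using rule_node_snocD[OF snoc.prems(1)] by blast
  have arc: "(descend w, descend (w @ [i])) \<in> parcs T"
    by (rule descend_arc[OF m])
  show ?case
  proof (cases w' rule: rev_cases)
    case Nil
    then show ?thesis using arc snoc.prems(3) no_arc_to_root by simp
  next
    case w': (snoc u j)
    have "(u @ [j], l') \<in> rule_nodes R" using snoc.prems(2) w' by simp
    then obtain n where n: "(u, n) \<in> rule_nodes R" "j < length (productions R n)"
      by (blast dest: rule_node_snocD)
    have "(descend u, descend (w @ [i])) \<in> parcs T"
      using descend_arc[OF n] by (simp only: snoc.prems(3) w')
    then have "descend w = descend u" by (rule parent_unique[OF arc])
    then have "w = u" using snoc.IH m(1) n(1) by blast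
    moreover have "i = j"
      using snoc.prems(3) m n \<open>w = u\<close> descend_rule_node[OF m(1)] descend_rule_node[OF n(1)]
      by (simp add: w' nth_eq_iff_index_eq distinct_children length_children)
    ultimately show ?thesis by (simp add: w')
  qed
qed

lemma descend_child:
  assumes "(w, l) \<in> rule_nodes R" and "y \<in> set (children (descend w))"
  shows "\<exists>i < length (productions R l). descend (w @ [i]) = y"
  using assms descend_rule_node[OF assms(1)] by (auto simp: in_set_conv_nth length_children)

lemma descend_surj: "x \<in> pverts T \<Longrightarrow> \<exists>w l. (w, l) \<in> rule_nodes R \<and> descend w = x"
proof (induction "depth x" arbitrary: x rule: less_induct)
  case less
  show ?case
  proof (cases "x = r")
    case True
    then show ?thesis using rule_nodes.root_node descend_Nil by blast
  next
    case False
    then obtain u where u: "(u, x) \<in> parcs T"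
      using ex_parent less.prems by blast
    then obtain w l where w: "(w, l) \<in> rule_nodes R" "descend w = u"
      using less.hyps[of u] depth_arc[OF u] in_arcsD1[OF u] by auto
    then obtain i where "i < length (productions R l)" "descend (w @ [i]) = x"
      using descend_child[of w l x] u by (auto simp: arcs_children)
    then show ?thesis
      using rule_nodes.child_node[OF w(1)] by blast
  qed
qed

lemma rule_tree_iso: "rooted_tree_iso T r (rule_tree R) (rule_root R)"
proof -
  define g where "g = (\<lambda>node :: nat list \<times> 'l. descend (fst node))"
  have "pair_wf_digraph (rule_tree R)"
    by (auto simp: pair_wf_digraph_def rule_tree_def intro: rule_nodes.child_node)
  moreover have "inj_on g (rule_nodes R)"
    by (rule inj_onI) (metis g_def descend_inj descend_rule_node prod.collapse)
  then have "bij_betw g (pverts (rule_tree R)) (pverts T)"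
    using descend_rule_node descend_surj
    by (force simp: bij_betw_def rule_tree_def g_def)
  moreover have "parcs T = map_prod g g ` parcs (rule_tree R)"
  proof (intro equalityI subsetI)
    fix e assume e: "e \<in> parcs T"
    obtain x y where xy: "e = (x, y)" by (cases e)
    obtain w l where w: "(w, l) \<in> rule_nodes R" "descend w = x"
      using descend_surj[of x] e xy by (auto simp: arcs_children)
    then obtain i where i: "i < length (productions R l)" "descend (w @ [i]) = y"
      using descend_child[of w l y] e xy by (auto simp: arcs_children)
    have "((w, l), (w @ [i], productions R l ! i)) \<in> parcs (rule_tree R)"
      using w i by (auto simp: rule_tree_def)
    then show "e \<in> map_prod g g ` parcs (rule_tree R)"
      by (rule rev_image_eqI) (simp only: xy g_def map_prod_simp fst_conv w i)
  next
    fix e assume "e \<in> map_prod g g ` parcs (rule_tree R)"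
    then show "e \<in> parcs T"
      using descend_arc by (auto simp: rule_tree_def g_def simp del: descend_snoc)
  qed
  moreover have "rule_root R \<in> pverts (rule_tree R)"
    by (simp add: rule_root_def rule_tree_def rule_nodes.root_node)
  ultimately have "rooted_tree_iso T (g (rule_root R)) (rule_tree R) (rule_root R)"
    by (rule rooted_tree_isoI)
  then show ?thesis by (simp add: g_def rule_root_def)
qed

end

section \<open>Inserting a value on the right\<close>

lemma is_perm_iff: "is_perm p \<longleftrightarrow> set p = {1..length p}"
  by (auto simp: is_perm_def permutations_of_set_def intro: card_distinct)

text \<open>
  The relabelling of old entries when \<open>a\<close> is appended. It skips the value \<open>a\<close>, and \<open>collapse\<close> is
  its left inverse that merges the sites \<open>a\<close> and \<open>a + 1\<close>. The two are adjoint in the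
  sense of \<open>bump_less_iff\<close> and \<open>le_bump_iff\<close>, which is what translates inequalities between
  entries and sites of the larger permutation into the smaller one.
\<close>

definition bump :: "nat \<Rightarrow> nat \<Rightarrow> nat" where
  "bump a x = (if x < a then x else x + 1)"

definition collapse :: "nat \<Rightarrow> nat \<Rightarrow> nat" where
  "collapse a b = (if b \<le> a then b else b - 1)"

lemma bump_less_iff: "bump a x < b \<longleftrightarrow> x < collapse a b"
  by (auto simp: bump_def collapse_def)

lemma le_bump_iff: "b \<le> bump a x \<longleftrightarrow> collapse a b \<le> x"
  by (auto simp: bump_def collapse_def)

lemma collapse_bump [simp]: "collapse a (bump a x) = x"
  by (simp add: bump_def collapse_def)

lemma bump_collapse: "b \<noteq> a \<Longrightarrow> bump a (collapse a b) = b"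
  by (auto simp: bump_def collapse_def)

lemma bump_less_bump_iff: "bump a x < bump a y \<longleftrightarrow> x < y"
  by (simp add: bump_less_iff)

lemma bump_eq_iff: "bump a x = bump a y \<longleftrightarrow> x = y"
  by (metis collapse_bump)

lemma insert_right_eq: "insert_right p a = map (bump a) p @ [a]"
  by (simp add: insert_right_def bump_def)

lemma length_insert_right [simp]: "length (insert_right p a) = length p + 1"
  by (simp add: insert_right_def)

lemma last_insert_right [simp]: "last (insert_right p a) = a"
  by (simp add: insert_right_def)

lemma nth_insert_right:
  "i < length p \<Longrightarrow> insert_right p a ! i = bump a (p ! i)"
  "insert_right p a ! length p = a"
  by (simp_all add: insert_right_eq nth_append)

lemma insert_right_eq_iff: "insert_right p a = insert_right q b \<longleftrightarrow> p = q \<and> a = b"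
proof -
  have "inj (bump a)" by (simp add: inj_def bump_eq_iff)
  then show ?thesis by (auto simp: insert_right_eq inj_map_eq_map)
qed

lemma is_perm_insert_right:
  assumes "is_perm p" and "a \<in> {1..length p + 1}"
  shows "is_perm (insert_right p a)"
proof -
  have "bump a ` {1..length p} = {1..length p + 1} - {a}"
  proof (intro equalityI subsetI)
    fix y assume y: "y \<in> {1..length p + 1} - {a}"
    then have "y = bump a (collapse a y)" "collapse a y \<in> {1..length p}"
      using assms(2) by (auto simp: bump_def collapse_def)
    then show "y \<in> bump a ` {1..length p}" by blast
  qed (auto simp: bump_def split: if_splits)
  then show ?thesis
    using assms by (auto simp: is_perm_iff insert_right_eq)
qed

text \<open>
  Every permutation arises by insertion: delete the last entry and close the gap it leaves among
  the values.
\<close>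

lemma perm_eq_insert_right:
  assumes "is_perm p" and "p \<noteq> []"
  obtains q a where "p = insert_right q a" "is_perm q" "a \<in> {1..length q + 1}"
proof -
  obtain xs a where p: "p = xs @ [a]" using assms(2) by (metis rev_exhaust)
  have d: "distinct p" and s: "set p = {1..length p}"
    using assms(1) by (auto simp: is_perm_def permutations_of_set_def)
  define q where "q = map (collapse a) xs"
  have a: "a \<in> {1..length q + 1}" using s by (auto simp: p q_def)
  have "set xs = set p - {a}" using d by (auto simp: p)
  then have xs: "set xs = {1..length xs + 1} - {a}" by (simp add: s) (simp add: p)
  have "map (bump a \<circ> collapse a) xs = xs"
    by (rule map_idI) (simp add: xs bump_collapse)
  then have pq: "p = insert_right q a" by (simp add: p q_def insert_right_eq)
  have "collapse a ` ({1..length xs + 1} - {a}) = {1..length xs}"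
  proof (intro equalityI subsetI)
    fix y assume "y \<in> {1..length xs}"
    then have "y = collapse a (bump a y)" "bump a y \<in> {1..length xs + 1} - {a}"
      by (auto simp: bump_def collapse_def)
    then show "y \<in> collapse a ` ({1..length xs + 1} - {a})" by blast
  qed (use a in \<open>auto simp: collapse_def q_def split: if_splits\<close>)
  then have "is_perm q" by (simp add: is_perm_iff q_def xs)
  then show ?thesis using that pq a by blast
qed

section \<open>Active sites\<close>

text \<open>
  The entries \<open>p ! i\<close>, \<open>p ! j\<close> and \<open>p ! (j + 1)\<close> become a forbidden 2413 when \<open>a\<close> is appended. The
  inequality \<open>a \<le> p ! j\<close> is not strict because \<open>p ! j\<close> moves above \<open>a\<close> if the two are equal.
\<close>

definition blocked :: "nat list \<Rightarrow> nat \<Rightarrow> bool" where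
  "blocked p a \<longleftrightarrow> (\<exists>i j. i < j \<and> j + 1 < length p \<and>
     p ! (j + 1) < p ! i \<and> p ! i < a \<and> a \<le> p ! j)"

definition active :: "nat list \<Rightarrow> nat set" where
  "active p = {a \<in> {1..length p + 1}. \<not> blocked p a}"

lemma finite_active [simp]: "finite (active p)"
  by (simp add: active_def)

text \<open>
  Occurrences of the pattern that avoid the new last entry are those of \<open>p\<close>, since \<open>bump a\<close>
  preserves order; in the others the new entry plays the role of 3, the only one in last position.
\<close>

lemma semi_baxter_insert_right:
  assumes "is_perm p" and "a \<in> {1..length p + 1}"
  shows "semi_baxter (insert_right p a) \<longleftrightarrow> semi_baxter p \<and> a \<in> active p"
proof -
  let ?q = "insert_right p a"
  define occ where "occ = (\<lambda>(p :: nat list) i j k.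
    p ! (j + 1) < p ! i \<and> p ! i < p ! k \<and> p ! k < p ! j)"
  have "occ ?q i j k \<longleftrightarrow> occ p i j k"
    if "i < j" "j + 1 < k" "k < length p" for i j k
    using that by (simp add: occ_def nth_insert_right bump_less_bump_iff)
  then have old: "(\<exists>i j k. i < j \<and> j + 1 < k \<and> k < length p \<and> occ ?q i j k) \<longleftrightarrow>
      (\<exists>i j k. i < j \<and> j + 1 < k \<and> k < length p \<and> occ p i j k)"
    by blast
  have "bump a x < a \<longleftrightarrow> x < a" "a < bump a x \<longleftrightarrow> a \<le> x" for x
    by (auto simp: bump_def)
  then have "occ ?q i j (length p) \<longleftrightarrow> p ! (j + 1) < p ! i \<and> p ! i < a \<and> a \<le> p ! j"
    if "i < j" "j + 1 < length p" for i j
    using that by (simp add: occ_def nth_insert_right bump_less_bump_iff)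
  then have new: "(\<exists>i j. i < j \<and> j + 1 < length p \<and> occ ?q i j (length p)) \<longleftrightarrow> blocked p a"
    unfolding blocked_def by blast
  have "k < length ?q \<longleftrightarrow> k < length p \<or> k = length p" for k
    by auto
  then have "(\<exists>i j k. i < j \<and> j + 1 < k \<and> k < length ?q \<and> occ ?q i j k) \<longleftrightarrow>
      (\<exists>i j k. i < j \<and> j + 1 < k \<and> k < length p \<and> occ ?q i j k) \<or>
      (\<exists>i j. i < j \<and> j + 1 < length p \<and> occ ?q i j (length p))"
    by blast
  then have "(\<exists>i j k. i < j \<and> j + 1 < k \<and> k < length ?q \<and> occ ?q i j k) \<longleftrightarrow>
      (\<exists>i j k. i < j \<and> j + 1 < k \<and> k < length p \<and> occ p i j k) \<or> blocked p a"
    unfolding old new .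
  then show ?thesis
    unfolding semi_baxter_def active_def occ_def[symmetric]
    using assms is_perm_insert_right[OF assms] by (simp add: occ_def)
qed

text \<open>
  The old descents block a site of the child exactly if they blocked the site it came from. The
  last two entries of the child form a descent only if \<open>a \<le> last p\<close>; its bottom is \<open>a\<close> and its top
  is \<open>last p + 1\<close>. All values in between occur earlier, and the smallest of them, \<open>a + 1\<close>,
  witnesses everything that the descent blocks.
\<close>

lemma blocked_insert_right:
  assumes "is_perm p" and "p \<noteq> []" and "a \<in> {1..length p + 1}"
  shows "blocked (insert_right p a) b \<longleftrightarrow>
    blocked p (collapse a b) \<or> (a + 1 < b \<and> b \<le> last p + 1)"
proof -
  let ?q = "insert_right p a" and ?n = "length p - 1"
  define occ where "occ = (\<lambda>(p :: nat list) b i j.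
    p ! (j + 1) < p ! i \<and> p ! i < b \<and> b \<le> p ! j)"
  have blocked: "blocked p b \<longleftrightarrow> (\<exists>i j. i < j \<and> j + 1 < length p \<and> occ p b i j)" for p b
    by (simp add: blocked_def occ_def)
  have n: "Suc ?n = length p" using assms(2) by simp
  have last: "p ! ?n = last p" using assms(2) by (simp add: last_conv_nth)
  have "occ ?q b i j \<longleftrightarrow> occ p (collapse a b) i j" if "i < j" "j + 1 < length p" for i j
    using that by (simp add: occ_def nth_insert_right bump_less_iff le_bump_iff)
  then have old: "(\<exists>i j. i < j \<and> j + 1 < length p \<and> occ ?q b i j) \<longleftrightarrow> blocked p (collapse a b)"
    unfolding blocked by blast
  have nth: "?q ! ?n = bump a (last p)" "?q ! (?n + 1) = a"
    using n last assms(2) by (simp_all add: nth_insert_right)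
  have new: "(\<exists>i < ?n. occ ?q b i ?n) \<longleftrightarrow> a + 1 < b \<and> b \<le> last p + 1"
  proof
    assume "\<exists>i < ?n. occ ?q b i ?n"
    then show "a + 1 < b \<and> b \<le> last p + 1"
      unfolding occ_def nth by (auto simp: bump_def split: if_splits)
  next
    assume ab: "a + 1 < b \<and> b \<le> last p + 1"
    have "last p \<le> length p"
      using assms(1,2) last_in_set[of p] by (simp add: is_perm_iff)
    \<comment> \<open>The witness is the old entry \<open>a\<close>, which appears as \<open>a + 1\<close> in the child.\<close>
    then have "a \<in> set p" using ab assms(1,3) by (simp add: is_perm_iff)
    then obtain i where i: "i < length p" "p ! i = a" by (auto simp: in_set_conv_nth)
    moreover have "i \<noteq> ?n" using i ab last by auto
    ultimately have "i < ?n" by simp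
    moreover have "?q ! i = a + 1" using i by (simp add: nth_insert_right bump_def)
    moreover have "bump a (last p) = last p + 1" using ab by (simp add: bump_def)
    ultimately show "\<exists>i < ?n. occ ?q b i ?n" unfolding occ_def nth using ab by auto
  qed
  have "j + 1 < length ?q \<longleftrightarrow> j + 1 < length p \<or> j = ?n" for j
    using n by auto
  then have "blocked ?q b \<longleftrightarrow>
      (\<exists>i j. i < j \<and> j + 1 < length p \<and> occ ?q b i j) \<or> (\<exists>i < ?n. occ ?q b i ?n)"
    unfolding blocked by blast
  then show ?thesis unfolding old new .
qed

lemma active_insert_right:
  assumes "is_perm p" and "p \<noteq> []" and "a \<in> active p"
  shows "active (insert_right p a) =
    {b. collapse a b \<in> active p \<and> \<not> (a + 1 < b \<and> b \<le> last p + 1)}"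
proof -
  have a: "a \<in> {1..length p + 1}" using assms(3) by (simp add: active_def)
  have "b \<in> {1..length p + 1 + 1} \<longleftrightarrow> collapse a b \<in> {1..length p + 1}" for b
    using a by (auto simp: collapse_def)
  then show ?thesis
    unfolding active_def using blocked_insert_right[OF assms(1,2) a] by auto
qed

lemma active_insert_right_le:
  assumes "is_perm p" and "p \<noteq> []" and "a \<in> active p"
  shows "{b \<in> active (insert_right p a). b \<le> a} = {b \<in> active p. b \<le> a}"
  by (auto simp: active_insert_right[OF assms] collapse_def)

lemma active_insert_right_greater:
  assumes "is_perm p" and "p \<noteq> []" and "a \<in> active p"
  shows "{b \<in> active (insert_right p a). a < b} =
    Suc ` {c \<in> active p. a \<le> c \<and> \<not> (a < c \<and> c \<le> last p)}"
proof (intro equalityI subsetI)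
  fix b assume "b \<in> {b \<in> active (insert_right p a). a < b}"
  then have "b = Suc (b - 1)" "b - 1 \<in> {c \<in> active p. a \<le> c \<and> \<not> (a < c \<and> c \<le> last p)}"
    by (auto simp: active_insert_right[OF assms] collapse_def)
  then show "b \<in> Suc ` {c \<in> active p. a \<le> c \<and> \<not> (a < c \<and> c \<le> last p)}" by blast
qed (auto simp: active_insert_right[OF assms] collapse_def)

section \<open>Labels and ordered children\<close>

definition low_sites :: "nat list \<Rightarrow> nat set" where
  "low_sites p = {a \<in> active p. a \<le> last p}"

definition high_sites :: "nat list \<Rightarrow> nat set" where
  "high_sites p = {a \<in> active p. last p < a}"

definition site_label :: "nat list \<Rightarrow> nat \<times> nat" where
  "site_label p = (card (low_sites p), card (high_sites p))"

text \<open>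
  The high sites are listed downwards because the productions \<open>(h + k, 1), \<dots>, (h + 1, k)\<close> begin with
  the highest one.
\<close>

definition site_list :: "nat list \<Rightarrow> nat list" where
  "site_list p = sorted_list_of_set (low_sites p) @ rev (sorted_list_of_set (high_sites p))"

lemma finite_sites [simp]: "finite (low_sites p)" "finite (high_sites p)"
  by (simp_all add: low_sites_def high_sites_def)

lemma set_site_list: "set (site_list p) = active p"
  by (auto simp: site_list_def low_sites_def high_sites_def)

lemma distinct_site_list: "distinct (site_list p)"
  by (auto simp: site_list_def low_sites_def high_sites_def)

text \<open>
  Of the low sites those above \<open>a\<close> are lost to the new descent, except that the upper half of the
  split site \<open>a\<close> survives and joins the high sites.
\<close>

lemma site_label_insert_right_low:
  assumes "is_perm p" and "p \<noteq> []" and "a \<in> low_sites p"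
  shows "site_label (insert_right p a) =
    (card {b \<in> low_sites p. b \<le> a}, card (high_sites p) + 1)"
proof -
  have a: "a \<in> active p" "a \<le> last p" using assms(3) by (auto simp: low_sites_def)
  have "low_sites (insert_right p a) = {b \<in> active p. b \<le> a}"
    by (simp add: low_sites_def active_insert_right_le[OF assms(1,2) a(1)])
  also have "\<dots> = {b \<in> low_sites p. b \<le> a}"
    using a by (auto simp: low_sites_def)
  finally have "low_sites (insert_right p a) = {b \<in> low_sites p. b \<le> a}" .
  moreover have "high_sites (insert_right p a) = Suc ` insert a (high_sites p)"
    unfolding high_sites_def last_insert_right active_insert_right_greater[OF assms(1,2) a(1)]
    using a by (intro arg_cong[where f = "image Suc"]) auto
  moreover have "a \<notin> high_sites p" using a by (simp add: high_sites_def)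
  ultimately show ?thesis
    by (simp only: site_label_def card_image[OF inj_Suc] card_insert_disjoint finite_sites) simp
qed

text \<open>
  Nothing is lost here, so the site \<open>a\<close> is counted once on either side after the split and the two
  components add up to \<open>h + k + 1\<close>.
\<close>

lemma site_label_insert_right_high:
  assumes "is_perm p" and "p \<noteq> []" and "a \<in> high_sites p"
  defines "g \<equiv> card {c \<in> high_sites p. a \<le> c}"
  shows "site_label (insert_right p a) =
    (card (low_sites p) + card (high_sites p) + 1 - g, g)"
proof -
  have a: "a \<in> active p" "last p < a" using assms(3) by (auto simp: high_sites_def)
  let ?U = "{b \<in> high_sites p. b \<le> a}" and ?G = "{c \<in> high_sites p. a \<le> c}"
  have "low_sites (insert_right p a) = {b \<in> active p. b \<le> a}"
    by (simp add: low_sites_def active_insert_right_le[OF assms(1,2) a(1)])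
  also have "\<dots> = low_sites p \<union> ?U"
    using a by (auto simp: low_sites_def high_sites_def)
  finally have "low_sites (insert_right p a) = low_sites p \<union> ?U" .
  moreover have "low_sites p \<inter> ?U = {}" by (auto simp: low_sites_def high_sites_def)
  ultimately have low: "card (low_sites (insert_right p a)) = card (low_sites p) + card ?U"
    by (simp add: card_Un_disjoint)
  have "high_sites (insert_right p a) = Suc ` ?G"
    unfolding high_sites_def last_insert_right active_insert_right_greater[OF assms(1,2) a(1)]
    using a by (intro arg_cong[where f = "image Suc"]) auto
  then have high: "card (high_sites (insert_right p a)) = g"
    by (simp add: card_image g_def)
  have "?U \<union> ?G = high_sites p" "?U \<inter> ?G = {a}"
    using assms(3) by auto
  then have "card ?U + g = card (high_sites p) + 1"
    using card_Un_Int[of ?U ?G] by (simp add: g_def)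
  then show ?thesis by (simp add: site_label_def low high)
qed

text \<open>
  The ranks of the members of a sorted list are \<open>1, 2, \<dots>\<close> in this order. A general order
  \<open>R\<close> covers both the ascending and the descending list of sites.
\<close>

lemma map_card_initial_segments:
  assumes "transp R" and "irreflp R" and "sorted_wrt R xs"
  shows "map (\<lambda>a. card {b \<in> set xs. R b a \<or> b = a}) xs = [1..<length xs + 1]"
  using assms(3)
proof (induction xs rule: rev_induct)
  case (snoc m xs)
  have xs: "sorted_wrt R xs" and m: "\<And>a. a \<in> set xs \<Longrightarrow> R a m"
    using snoc.prems by (auto simp: sorted_wrt_append)
  have neq: "\<not> R m a" "m \<noteq> a" if "a \<in> set xs" for a
    using m[OF that] assms(1,2) by (metis irreflpD transpD)+
  have "sorted_wrt R xs \<Longrightarrow> distinct xs" for xs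
    using assms(2) by (induction xs) (auto dest: irreflpD)
  then have d: "distinct xs" "m \<notin> set xs" using xs neq by auto
  have "{b \<in> set (xs @ [m]). R b a \<or> b = a} = {b \<in> set xs. R b a \<or> b = a}"
    if "a \<in> set xs" for a
    using neq[OF that] by auto
  moreover have "{b \<in> set (xs @ [m]). R b m \<or> b = m} = insert m (set xs)"
    using m by auto
  ultimately show ?case
    using snoc.IH[OF xs] d by (simp add: distinct_card cong: map_cong)
qed simp

lemma map_card_le_sorted_list:
  fixes A :: "nat set"
  assumes "finite A"
  shows "map (\<lambda>a. card {b \<in> A. b \<le> a}) (sorted_list_of_set A) = [1..<card A + 1]"
  using map_card_initial_segments[of "(<)" "sorted_list_of_set A"] assms
  by (simp add: le_less)

lemma map_card_ge_rev_sorted_list: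
  fixes A :: "nat set"
  assumes "finite A"
  shows "map (\<lambda>a. card {b \<in> A. a \<le> b}) (rev (sorted_list_of_set A)) = [1..<card A + 1]"
proof -
  have "transp ((>) :: nat \<Rightarrow> nat \<Rightarrow> bool)" "irreflp ((>) :: nat \<Rightarrow> nat \<Rightarrow> bool)"
    by (auto intro: transpI irreflpI)
  moreover have "sorted_wrt (>) (rev (sorted_list_of_set A))"
    by (simp add: sorted_wrt_rev)
  moreover have "(a < b \<or> b = a) \<longleftrightarrow> a \<le> b" for a b :: nat by auto
  ultimately show ?thesis
    using map_card_initial_segments[of "(>)" "rev (sorted_list_of_set A)"] assms by simp
qed

text \<open>
  The label of a child depends only on the rank of its site, from below for the low sites and
  from above for the high ones, and both families of ranks run through an initial segment of the
  positive integers in the order of the list.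
\<close>

lemma site_labels_of_children:
  assumes "is_perm p" and "p \<noteq> []"
  shows "map site_label (map (insert_right p) (site_list p)) =
    productions Omega_semi (site_label p)"
proof -
  let ?L = "sorted_list_of_set (low_sites p)" and ?H = "rev (sorted_list_of_set (high_sites p))"
  let ?h = "card (low_sites p)" and ?k = "card (high_sites p)"
  have "map (\<lambda>a. site_label (insert_right p a)) ?L =
      map (\<lambda>i. (i, ?k + 1)) (map (\<lambda>a. card {b \<in> low_sites p. b \<le> a}) ?L)"
    by (simp add: site_label_insert_right_low[OF assms])
  moreover have "map (\<lambda>a. site_label (insert_right p a)) ?H =
      map (\<lambda>i. (?h + ?k + 1 - i, i)) (map (\<lambda>a. card {b \<in> high_sites p. a \<le> b}) ?H)"
    by (simp only: map_map comp_def, rule map_cong)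
       (simp_all add: site_label_insert_right_high[OF assms])
  ultimately show ?thesis
    unfolding map_card_le_sorted_list[OF finite_sites(1)]
      map_card_ge_rev_sorted_list[OF finite_sites(2)]
    by (simp add: site_list_def site_label_def Omega_semi_def comp_def del: upt_Suc)
qed

lemma site_label_singleton: "site_label [1] = (1, 1)"
proof -
  have "active [1] = {1..2}" by (auto simp: active_def blocked_def)
  then have "low_sites [1] = {1}" "high_sites [1] = {2}"
    by (auto simp: low_sites_def high_sites_def)
  then show ?thesis by (simp add: site_label_def)
qed

section \<open>The tree of semi-Baxter permutations\<close>

lemma semi_baxter_permsD:
  assumes "p \<in> semi_baxter_perms"
  shows "is_perm p" "p \<noteq> []" "semi_baxter p"
  using assms by (auto simp: semi_baxter_perms_def semi_baxter_def)

lemma arcs_semi_baxter_tree: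
  "parcs semi_baxter_tree =
    {(p, q). p \<in> semi_baxter_perms \<and> q \<in> insert_right p ` active p}"
proof -
  have "a \<in> {1..length p + 1} \<and> semi_baxter (insert_right p a) \<longleftrightarrow> a \<in> active p"
    if "p \<in> semi_baxter_perms" for p a
    using semi_baxter_insert_right[of p a] semi_baxter_permsD[OF that]
    by (auto simp: active_def)
  then show ?thesis by (auto simp: semi_baxter_tree_def)
qed

text \<open>
  Without descents there is no pattern; this supplies a vertex at every level.
\<close>

lemma identity_semi_baxter: "semi_baxter [1..<n + 1]"
proof -
  have "is_perm [1..<n + 1]" by (auto simp: is_perm_iff simp del: upt_Suc)
  then show ?thesis unfolding semi_baxter_def by (auto simp del: upt_Suc)
qed

lemma infinite_semi_baxter_perms: "infinite semi_baxter_perms"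
proof
  assume "finite semi_baxter_perms"
  then have "finite (length ` semi_baxter_perms)" by simp
  moreover have "{1..} \<subseteq> length ` semi_baxter_perms"
  proof
    fix n :: nat assume "n \<in> {1..}"
    then have "[1..<n + 1] \<in> semi_baxter_perms"
      using identity_semi_baxter[of n] by (simp add: semi_baxter_perms_def del: upt_Suc)
    then show "n \<in> length ` semi_baxter_perms" by (rule rev_image_eqI) simp
  qed
  ultimately show False using infinite_Ici[of "1::nat"] finite_subset by blast
qed

interpretation semi_baxter: labelled_family semi_baxter_tree "[1]" length
  "\<lambda>p. map (insert_right p) (site_list p)" site_label Omega_semi
proof
  have V: "pverts semi_baxter_tree = semi_baxter_perms"
    by (simp add: semi_baxter_tree_def)
  fix p q p' :: "nat list" and e
  show "e \<in> parcs semi_baxter_tree \<Longrightarrow> fst e \<in> pverts semi_baxter_tree"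
    "e \<in> parcs semi_baxter_tree \<Longrightarrow> snd e \<in> pverts semi_baxter_tree"
    by (auto simp: semi_baxter_tree_def semi_baxter_perms_def)
  show "[1] \<in> pverts semi_baxter_tree"
    using identity_semi_baxter[of 1] by (simp add: V semi_baxter_perms_def)
  show "length [1] = 1" by simp
  show "p \<in> pverts semi_baxter_tree \<Longrightarrow> 1 \<le> length p"
    by (simp add: V semi_baxter_perms_def)
  show "(p, q) \<in> parcs semi_baxter_tree \<Longrightarrow> length q = length p + 1"
    by (auto simp: semi_baxter_tree_def)
  show "(p, q) \<in> parcs semi_baxter_tree \<Longrightarrow> (p', q) \<in> parcs semi_baxter_tree \<Longrightarrow> p = p'"
    by (auto simp: semi_baxter_tree_def insert_right_eq_iff)
  show "\<exists>p. (p, q) \<in> parcs semi_baxter_tree"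
    if q: "q \<in> pverts semi_baxter_tree" "q \<noteq> [1]"
  proof -
    have sq: "is_perm q" "q \<noteq> []" "semi_baxter q"
      using semi_baxter_permsD q(1) by (auto simp: V)
    obtain p a where pa: "q = insert_right p a" "is_perm p" "a \<in> {1..length p + 1}"
      using perm_eq_insert_right[OF sq(1,2)] by blast
    have "semi_baxter p" "a \<in> active p"
      using semi_baxter_insert_right[OF pa(2,3)] sq(3) by (simp_all add: pa(1))
    moreover have "p \<noteq> []" using q(2) pa(1,3) by (auto simp: insert_right_def)
    ultimately have "(p, q) \<in> parcs semi_baxter_tree"
      by (auto simp: arcs_semi_baxter_tree pa(1) semi_baxter_perms_def Suc_le_eq)
    then show ?thesis ..
  qed
  show "parcs semi_baxter_tree = {(x, y). x \<in> pverts semi_baxter_tree \<and>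
      y \<in> set (map (insert_right x) (site_list x))}"
    by (simp add: arcs_semi_baxter_tree V set_site_list)
  show "distinct (map (insert_right p) (site_list p))"
    by (simp add: distinct_map distinct_site_list inj_on_def insert_right_eq_iff)
  show "site_label [1] = root_label Omega_semi"
    using site_label_singleton by (simp add: Omega_semi_def)
  show "p \<in> pverts semi_baxter_tree \<Longrightarrow>
      map site_label (map (insert_right p) (site_list p)) = productions Omega_semi (site_label p)"
    by (rule site_labels_of_children) (auto simp: V dest: semi_baxter_permsD)
qed

theorem proposition3:
  shows "generating_tree semi_baxter_tree [1] semi_baxter_perms length \<and>
         rooted_tree_iso semi_baxter_tree [1] (rule_tree Omega_semi) (rule_root Omega_semi)"
proof
  have "pverts semi_baxter_tree = semi_baxter_perms"
    by (simp add: semi_baxter_tree_def)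
  then show "generating_tree semi_baxter_tree [1] semi_baxter_perms length"
    unfolding generating_tree_def
    using semi_baxter.rooted_tree semi_baxter.level_eq_depth infinite_semi_baxter_perms by auto
  show "rooted_tree_iso semi_baxter_tree [1] (rule_tree Omega_semi) (rule_root Omega_semi)"
    by (rule semi_baxter.rule_tree_iso)
qed

end
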